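(* Let $A$ be a $d$-dimensional point configuration with degree $\delta := \deg(A) < \frac{d}{3}$. Then $A$ admits a weak Cayley decomposition of length at least $d-3\delta+1$ (i.e. of some length $m \ge d-3\delta+1$).
   Context: A $d$-dimensional point configuration is a finite family $A$ of points whose affine span is $\mathbb{R}^d$; repeated points are allowed, and repeated points are treated as distinct labelled elements (so subsets and partitions of $A$ are subsets and partitions of the labelled family). A non-empty subset $S\subseteq A$ is an interior face of $A$ if $\mathrm{conv}(S)$ is not contained in the boundary of $\mathrm{conv}(A)$. The degree $\deg(A)$ is the maximal codimension $d-\dim \mathrm{conv}(S)$ of an interior face $S$ of $A$. A weak Cayley decomposition of $A$ of length $m\ge 1$ is a partition $A=A_0\uplus A_1\uplus\cdots\uplus A_m$ with $A_1,\dots,A_m$ non-empty ($A_0$ may be empty) such that for every $1\le i\le m$, $A\setminus A_i$ is exactly the set of points of $A$ lying in some proper face of $\mathrm{conv}(A)$ (a face different from $\mathrm{conv}(A)$; the empty face is allowed). The sets $A_1,\dots,A_m$ are called factors. *)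

theory Defs
  imports "HOL-Analysis.Analysis"
begin

text \<open>A family of points is an index (label) set \<^term>\<open>I\<close> together with a map \<^term>\<open>p\<close>; sub-families are
  subsets of \<^term>\<open>I\<close>, and \<^term>\<open>p\<close> need not be injective, so points may be repeated. The ambient
  dimension \<open>d\<close> is the dimension of the Euclidean space \<^typ>\<open>'a::euclidean_space\<close>.\<close>

definition point_configuration :: "'i set \<Rightarrow> ('i \<Rightarrow> 'a::euclidean_space) \<Rightarrow> bool" where
  "point_configuration I p \<longleftrightarrow> finite I \<and> affine hull (p ` I) = UNIV"

definition interior_face :: "'i set \<Rightarrow> ('i \<Rightarrow> 'a::euclidean_space) \<Rightarrow> 'i set \<Rightarrow> bool" where
  "interior_face I p S \<longleftrightarrow>
     S \<noteq> {} \<and> S \<subseteq> I \<and> \<not> convex hull (p ` S) \<subseteq> frontier (convex hull (p ` I))"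

text \<open>For a point configuration, \<^term>\<open>I\<close> itself is an interior face, so the maximum below is taken over
  a finite non-empty set, and it is non-negative.\<close>

definition config_degree :: "'i set \<Rightarrow> ('i \<Rightarrow> 'a::euclidean_space) \<Rightarrow> int" where
  "config_degree I p =
     Max {int DIM('a) - aff_dim (convex hull (p ` S)) | S. interior_face I p S}"

text \<open>The parts are \<open>A 0, \<dots>, A m\<close>, with factors \<open>A 1, \<dots>, A m\<close>. The relation \<open>face_of\<close> admits the
  empty face and the improper face; the latter is excluded explicitly.\<close>

definition weak_cayley_decomposition ::
    "'i set \<Rightarrow> ('i \<Rightarrow> 'a::euclidean_space) \<Rightarrow> nat \<Rightarrow> (nat \<Rightarrow> 'i set) \<Rightarrow> bool" where
  "weak_cayley_decomposition I p m A \<longleftrightarrow>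
     1 \<le> m \<and> (\<Union>i\<le>m. A i) = I \<and> disjoint_family_on A {..m} \<and>
     (\<forall>i\<in>{1..m}. A i \<noteq> {} \<and>
       (\<exists>F. F face_of convex hull (p ` I) \<and> F \<noteq> convex hull (p ` I) \<and>
            I - A i = {x \<in> I. p x \<in> F}))"

end

theory Submission
  imports Defs
begin

text \<open>Homogenise: \<open>p i\<close> becomes the vector \<open>(p i, 1)\<close> in dimension \<open>D = d + 1\<close>, and an interior face
  becomes a subfamily on which no non-zero linear functional that is non-negative on the whole
  family vanishes. Let \<open>T\<close> be an interior subfamily of minimal size \<open>k\<close>; then \<open>k \<ge> D - \<delta>\<close>. Modulo
  \<open>span T\<close> the family spans positively, so by Steinitz's theorem \<open>T\<close> extends to a spanning \<open>V\<close> of size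
  at most \<open>2 D - k\<close> with a linear relation that is positive on \<open>V - T\<close>. Take a linear relation \<open>\<rho>\<close> on
  \<open>V\<close> of maximal support and let \<open>L\<close> be its set of zeros. The sets \<open>\<rho> \<ge> 0\<close> and \<open>\<rho> \<le> 0\<close> are both interior,
  so each has at least \<open>k\<close> elements, whence \<open>card L \<ge> 2 k - card V \<ge> 3 k - 2 D \<ge> D - 3 \<delta>\<close>. Every \<open>l\<close> in
  \<open>L\<close> is independent of the rest of \<open>V\<close>, which gives a functional \<open>f l\<close> that vanishes on \<open>V - {l}\<close> and is positive at
  \<open>l\<close>. If \<open>f l\<close> were negative somewhere, \<open>T - {l}\<close> would be interior; if \<open>f l\<close> and \<open>f l'\<close> were both
  positive at \<open>i\<close>, then \<open>T - {l, l'}\<close> together with \<open>i\<close> would be interior. Both contradict the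
  minimality of \<open>T\<close>. So the supports of the \<open>f l\<close> are the factors.\<close>

section \<open>Positive spanning modulo an interior subfamily\<close>

text \<open>In cone terms, \<open>T\<close> lies on no proper face of the cone generated by the
  family. Asking for \<open>g = 0\<close>, and not just for \<open>g\<close> to vanish on
  \<open>I\<close>, also forces the family to span.\<close>

definition interior_vectors :: "'i set \<Rightarrow> ('i \<Rightarrow> 'b::euclidean_space) \<Rightarrow> 'i set \<Rightarrow> bool" where
  "interior_vectors I v T \<longleftrightarrow>
     T \<subseteq> I \<and> (\<forall>g. (\<forall>i\<in>I. 0 \<le> g \<bullet> v i) \<and> (\<forall>i\<in>T. g \<bullet> v i = 0) \<longrightarrow> g = 0)"

lemma interior_vectorsD:
  assumes "interior_vectors I v T" "\<And>i. i \<in> I \<Longrightarrow> 0 \<le> g \<bullet> v i" "\<And>i. i \<in> T \<Longrightarrow> g \<bullet> v i = 0"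
  shows "g = 0"
  using assms by (auto simp: interior_vectors_def)

lemma eq_0_if_orthogonal_spanning:
  assumes "span (v ` V) = UNIV" "\<And>i. i \<in> V \<Longrightarrow> g \<bullet> v i = 0"
  shows "g = 0"
proof -
  have "orthogonal g x" if "x \<in> v ` V" for x
    using that assms(2) by (auto simp: orthogonal_def)
  then have "orthogonal g g"
    using orthogonal_to_span[of g "v ` V" g] assms(1) by auto
  then show ?thesis by (simp add: orthogonal_def)
qed

text \<open>Indexed, so that equal vectors under different labels count separately: a repetition
  gives the coefficients 1 and -1; otherwise the image is too large to be independent.\<close>

lemma family_relation_exists:
  fixes h :: "'j \<Rightarrow> 'b::euclidean_space"
  assumes fin: "finite J" and card: "DIM('b) < card J"
  obtains \<mu> where "\<exists>j\<in>J. \<mu> j \<noteq> (0::real)" "(\<Sum>j\<in>J. \<mu> j *\<^sub>R h j) = 0"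
proof (cases "inj_on h J")
  case True
  then have "dependent (h ` J)"
    using dependent_biggerset[of "h ` J"] card fin by (simp add: card_image)
  then obtain u where u: "\<exists>x\<in>h ` J. u x \<noteq> 0" "(\<Sum>x\<in>h ` J. u x *\<^sub>R x) = 0"
    using dependent_finite[of "h ` J"] fin by auto
  show ?thesis
    by (rule that[of "u \<circ> h"]) (use u True in \<open>auto simp: sum.reindex\<close>)
next
  case False
  then obtain a b where ab: "a \<in> J" "b \<in> J" "a \<noteq> b" "h a = h b"
    by (auto simp: inj_on_def)
  let ?\<mu> = "(\<lambda>j. if j = a then 1 else if j = b then - 1 else 0) :: 'j \<Rightarrow> real"
  have "(\<Sum>j\<in>J. ?\<mu> j *\<^sub>R h j) = (\<Sum>j\<in>{a,b}. ?\<mu> j *\<^sub>R h j)"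
    by (rule sum.mono_neutral_right) (use fin ab in auto)
  then show ?thesis
    using ab by (intro that[of ?\<mu>]) auto
qed

text \<open>By separation: a point outside the closure of the cone yields a functional bounded below
  on the cone, hence nonnegative on \<open>I\<close> and zero on \<open>T\<close>, so interiority
  makes it zero.\<close>

lemma interior_vectors_cone_eq_UNIV:
  fixes v :: "'i \<Rightarrow> 'b::euclidean_space"
  assumes int: "interior_vectors I v T" and fin: "finite I"
  shows "\<exists>c s. (\<forall>i\<in>I. 0 \<le> c i) \<and> s \<in> span (v ` T) \<and> y = (\<Sum>i\<in>I. c i *\<^sub>R v i) + s"
proof -
  define K where "K = {x. \<exists>c s. (\<forall>i\<in>I. (0::real) \<le> c i) \<and> s \<in> span (v ` T) \<and>
                          x = (\<Sum>i\<in>I. c i *\<^sub>R v i) + s}"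
  have K_scale: "a *\<^sub>R x \<in> K" if x: "x \<in> K" and a: "0 \<le> a" for a x
  proof -
    obtain c s where cs: "\<forall>i\<in>I. 0 \<le> c i" "s \<in> span (v ` T)" "x = (\<Sum>i\<in>I. c i *\<^sub>R v i) + s"
      using x unfolding K_def by blast
    then show ?thesis
      unfolding K_def using a
      by (auto intro!: exI[of _ "\<lambda>i. a * c i"] exI[of _ "a *\<^sub>R s"]
          simp: span_scale scaleR_sum_right scaleR_add_right)
  qed
  have K_add: "x + y \<in> K" if xy: "x \<in> K" "y \<in> K" for x y
  proof -
    obtain c s c' s' where "\<forall>i\<in>I. 0 \<le> c i" "s \<in> span (v ` T)" "x = (\<Sum>i\<in>I. c i *\<^sub>R v i) + s"
      "\<forall>i\<in>I. 0 \<le> c' i" "s' \<in> span (v ` T)" "y = (\<Sum>i\<in>I. c' i *\<^sub>R v i) + s'"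
      using xy unfolding K_def by blast
    then show ?thesis
      unfolding K_def
      by (auto intro!: exI[of _ "\<lambda>i. c i + c' i"] exI[of _ "s + s'"]
          simp: span_add sum.distrib scaleR_add_left)
  qed
  have convK: "convex K"
    unfolding convex_def using K_scale K_add by blast
  have K_span: "s \<in> K" if "s \<in> span (v ` T)" for s
    unfolding K_def using that by (auto intro!: exI[of _ "\<lambda>_. 0"])
  have K_gen: "v i \<in> K" if "i \<in> I" for i
  proof -
    have "(\<Sum>j\<in>I. (if j = i then 1 else 0 :: real) *\<^sub>R v j) = (\<Sum>j\<in>I. if j = i then v i else 0)"
      by (intro sum.cong) auto
    also have "\<dots> = v i"
      using that fin by simp
    finally show ?thesis
      unfolding K_def using span_0[of "v ` T"]
      by (auto intro!: exI[of _ "\<lambda>j. if j = i then 1 else 0"] exI[of _ 0])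
  qed
  \<comment> \<open>A dense convex set is everything, so closedness of finitely generated cones is not needed.\<close>
  have "closure K = UNIV"
  proof (rule ccontr)
    assume "closure K \<noteq> UNIV"
    then obtain z where "z \<notin> closure K" by auto
    then obtain a b where ab: "a \<bullet> z < b" "\<forall>x\<in>closure K. b < a \<bullet> x"
      using separating_hyperplane_closed_point[of "closure K" z] convK by (auto simp: convex_closure)
    have b: "b < a \<bullet> x" if "x \<in> K" for x
      using ab(2) that closure_subset by blast
    have "b < 0"
      using b[OF K_span[of 0]] span_0 by auto
    have nonneg: "0 \<le> a \<bullet> x" if "x \<in> K" for x
    proof (rule ccontr)
      assume neg: "\<not> 0 \<le> a \<bullet> x"
      \<comment> \<open>Both \<open>b\<close> and \<open>a \<bullet> x\<close> are negative, so the
        factor is positive and the rescaled point takes exactly the value \<open>b\<close>, which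
        the strict bound excludes.\<close>
      have "b < a \<bullet> ((b / (a \<bullet> x)) *\<^sub>R x)"
        using \<open>b < 0\<close> neg that by (intro b K_scale) (auto simp: divide_simps)
      also have "\<dots> = b"
        using neg by simp
      finally show False by simp
    qed
    have "a \<bullet> v i = 0" if "i \<in> T" for i
    proof -
      have "v i \<in> span (v ` T)" using that by (simp add: span_base)
      then have "0 \<le> a \<bullet> v i" "0 \<le> a \<bullet> (- v i)"
        using nonneg K_span span_neg by blast+
      then show ?thesis by simp
    qed
    then have "a = 0"
      using nonneg K_gen by (intro interior_vectorsD[OF int]) auto
    then show False
      using ab(1) \<open>b < 0\<close> by simp
  qed
  then have "K = UNIV"
    using convex_interior_closure[OF convK] interior_subset[of K] by auto
  then show ?thesis
    unfolding K_def by blast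
qed

text \<open>Caratheodory's argument modulo the span of \<open>T\<close>: for \<open>Q\<close> of
  least size, too many vectors from \<open>Q\<close> and a basis of that span would satisfy a
  relation that allows a label to be removed from \<open>Q\<close>.\<close>

lemma interior_vectors_caratheodory:
  fixes v :: "'i \<Rightarrow> 'b::euclidean_space"
  assumes int: "interior_vectors I v T" and fin: "finite I"
  obtains c Q s where "Q \<subseteq> I" "card Q + dim (v ` T) \<le> DIM('b)" "\<And>i. i \<in> Q \<Longrightarrow> (0::real) < c i"
    "s \<in> span (v ` T)" "y = (\<Sum>i\<in>Q. c i *\<^sub>R v i) + s"
proof -
  define R where "R = (\<lambda>Q. Q \<subseteq> I \<and> (\<exists>c s. (\<forall>i\<in>Q. (0::real) < c i) \<and> s \<in> span (v ` T) \<and>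
                          y = (\<Sum>i\<in>Q. c i *\<^sub>R v i) + s))"
  have R_intro: "R {i\<in>Q. c i \<noteq> 0}"
    if "Q \<subseteq> I" "\<And>i. i \<in> Q \<Longrightarrow> 0 \<le> c i" "s \<in> span (v ` T)" "y = (\<Sum>i\<in>Q. c i *\<^sub>R v i) + s" for Q c s
  proof -
    have "(\<Sum>i\<in>Q. c i *\<^sub>R v i) = (\<Sum>i\<in>{i\<in>Q. c i \<noteq> 0}. c i *\<^sub>R v i)"
      using finite_subset[OF that(1) fin] by (intro sum.mono_neutral_right) auto
    then show ?thesis
      unfolding R_def using that by (auto simp: order.strict_iff_order intro!: exI[of _ c] exI[of _ s])
  qed
  obtain c0 s0 where "\<forall>i\<in>I. (0::real) \<le> c0 i" "s0 \<in> span (v ` T)" "y = (\<Sum>i\<in>I. c0 i *\<^sub>R v i) + s0"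
    using interior_vectors_cone_eq_UNIV[OF int fin, of y] by auto
  then have "\<exists>Q. R Q"
    using R_intro[of I c0 s0] by auto
  then obtain Q where RQ: "R Q" and minQ: "\<And>Q'. R Q' \<Longrightarrow> card Q \<le> card Q'"
    using ex_has_least_nat[of R _ card] by metis
  obtain c s where cs: "Q \<subseteq> I" "\<And>i. i \<in> Q \<Longrightarrow> (0::real) < c i"
    "s \<in> span (v ` T)" "y = (\<Sum>i\<in>Q. c i *\<^sub>R v i) + s"
    using RQ unfolding R_def by blast
  have finQ: "finite Q" using cs(1) fin finite_subset by blast
  have "card Q + dim (v ` T) \<le> DIM('b)"
  proof (rule ccontr)
    assume big: "\<not> ?thesis"
    obtain B where B: "B \<subseteq> v ` T" "independent B" "v ` T \<subseteq> span B" "card B = dim (v ` T)"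
      using basis_exists by blast
    have finB: "finite B" using B(2) independent_imp_finite by blast
    \<comment> \<open>The disjoint sum keeps a label of \<open>Q\<close> apart from a basis vector
      even if \<open>v\<close> maps one to the other.\<close>
    obtain \<mu> where \<mu>: "\<exists>j\<in>Q <+> B. \<mu> j \<noteq> 0" "(\<Sum>j\<in>Q <+> B. \<mu> j *\<^sub>R case_sum v id j) = 0"
      by (rule family_relation_exists[of "Q <+> B" "case_sum v id"])
         (use big B finQ finB in \<open>auto simp: card_Plus\<close>)
    have sum0: "(\<Sum>i\<in>Q. \<mu> (Inl i) *\<^sub>R v i) + (\<Sum>b\<in>B. \<mu> (Inr b) *\<^sub>R b) = 0"
      using \<mu>(2) finQ finB by (simp add: sum.Plus)
    have ex: "\<exists>q\<in>Q. \<mu> (Inl q) \<noteq> 0"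
    proof (rule ccontr)
      assume no: "\<not> ?thesis"
      then have "(\<Sum>b\<in>B. \<mu> (Inr b) *\<^sub>R b) = 0" using sum0 by simp
      then have "\<forall>b\<in>B. \<mu> (Inr b) = 0"
        using independentD[OF B(2) finB subset_refl, of "\<lambda>b. \<mu> (Inr b)"] by blast
      then show False using \<mu>(1) no by auto
    qed
    have sp: "(\<Sum>b\<in>B. \<mu> (Inr b) *\<^sub>R b) \<in> span (v ` T)"
      using B(1) by (intro span_sum span_scale span_base) auto
    \<comment> \<open>\<open>\<nu>\<close> is the \<open>Q\<close>-part of \<open>\<mu>\<close>,
      negated if necessary to have a positive entry; the \<open>B\<close>-part is absorbed into the
      span.\<close>
    obtain \<nu> where \<nu>: "\<exists>q\<in>Q. 0 < \<nu> q" "(\<Sum>i\<in>Q. \<nu> i *\<^sub>R v i) \<in> span (v ` T)"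
    proof (cases "\<exists>q\<in>Q. 0 < \<mu> (Inl q)")
      case True
      have "(\<Sum>i\<in>Q. \<mu> (Inl i) *\<^sub>R v i) = - (\<Sum>b\<in>B. \<mu> (Inr b) *\<^sub>R b)"
        using sum0 by (simp add: eq_neg_iff_add_eq_0)
      then show ?thesis
        using that[of "\<lambda>q. \<mu> (Inl q)"] sp True by (simp add: span_neg)
    next
      case False
      then have "\<exists>q\<in>Q. 0 < - \<mu> (Inl q)" using ex by force
      moreover have "(\<Sum>i\<in>Q. (- \<mu> (Inl i)) *\<^sub>R v i) = (\<Sum>b\<in>B. \<mu> (Inr b) *\<^sub>R b)"
        using sum0 by (simp add: sum_negf neg_eq_iff_add_eq_0)
      ultimately show ?thesis
        using that[of "\<lambda>q. - \<mu> (Inl q)"] sp by simp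
    qed
    define X where "X = {q\<in>Q. 0 < \<nu> q}"
    have X: "finite X" "X \<noteq> {}" using finQ \<nu>(1) by (auto simp: X_def)
    \<comment> \<open>Ratio test: the least quotient is the largest multiple of \<open>\<nu>\<close>
      that can be subtracted from \<open>c\<close> with all coefficients staying nonnegative, and it
      cancels the one at \<open>q\<close>.\<close>
    define q where "q = arg_min_on (\<lambda>q. c q / \<nu> q) X"
    have q: "q \<in> X" "\<And>x. x \<in> X \<Longrightarrow> c q / \<nu> q \<le> c x / \<nu> x"
      using arg_min_if_finite[OF X, of "\<lambda>q. c q / \<nu> q"] unfolding q_def by force+
    define t where "t = c q / \<nu> q"
    have tpos: "0 < t" using q(1) cs(2) by (auto simp: X_def t_def)
    define c' where "c' = (\<lambda>i. c i - t * \<nu> i)"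
    have c'nn: "0 \<le> c' i" if "i \<in> Q" for i
    proof (cases "0 < \<nu> i")
      case True
      then show ?thesis using q(2)[of i] that by (auto simp: X_def c'_def t_def field_simps)
    next
      case False
      then have "t * \<nu> i \<le> 0" using tpos by (simp add: mult_le_0_iff)
      then show ?thesis using cs(2)[OF that] by (simp add: c'_def)
    qed
    have "c' q = 0" using q(1) by (auto simp: c'_def t_def X_def)
    have "y = (\<Sum>i\<in>Q. c' i *\<^sub>R v i) + (s + t *\<^sub>R (\<Sum>i\<in>Q. \<nu> i *\<^sub>R v i))"
      by (simp add: cs(4) c'_def scaleR_diff_left sum_subtractf scaleR_sum_right)
    then have "R {i\<in>Q. c' i \<noteq> 0}"
      using cs(1,3) \<nu>(2) c'nn by (intro R_intro) (auto simp: span_add span_scale)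
    moreover have "card {i\<in>Q. c' i \<noteq> 0} < card Q"
      using finQ q(1) \<open>c' q = 0\<close> by (intro psubset_card_mono) (auto simp: X_def)
    ultimately show False using minQ by force
  qed
  then show ?thesis using that cs by blast
qed

section \<open>Linear relations of maximal support and dual functionals\<close>

text \<open>Adding a generic multiple of one relation to another unites their supports, so a largest
  support contains all others. The zeros of \<open>\<rho>\<close> are the coloops of the family on
  \<open>V\<close>.\<close>

lemma max_support_relation:
  fixes v :: "'i \<Rightarrow> 'b::real_vector"
  assumes fin: "finite V"
  obtains \<rho> where "(\<Sum>i\<in>V. \<rho> i *\<^sub>R v i) = 0"
    "\<And>\<mu> i. (\<Sum>i\<in>V. \<mu> i *\<^sub>R v i) = 0 \<Longrightarrow> i \<in> V \<Longrightarrow> \<rho> i = 0 \<Longrightarrow> \<mu> i = (0::real)"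
proof -
  define R where "R = (\<lambda>\<rho>. (\<Sum>i\<in>V. \<rho> i *\<^sub>R v i) = 0)"
  define supp where "supp = (\<lambda>\<rho>. {i\<in>V. \<rho> i \<noteq> (0::real)})"
  have "R (\<lambda>_. 0)" by (simp add: R_def)
  moreover have "card (supp \<rho>) < Suc (card V)" for \<rho>
    using card_mono[OF fin, of "supp \<rho>"] by (auto simp: supp_def)
  ultimately obtain \<rho> where \<rho>: "R \<rho>" "\<And>\<mu>. R \<mu> \<Longrightarrow> card (supp \<mu>) \<le> card (supp \<rho>)"
    using ex_has_greatest_nat[of R "\<lambda>_. 0" "\<lambda>\<rho>. card (supp \<rho>)" "Suc (card V)"] by (metis less_or_eq_imp_le)
  have "\<mu> j = 0" if \<mu>: "R \<mu>" and j: "j \<in> V" "\<rho> j = 0" for \<mu> j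
  proof (rule ccontr)
    assume "\<mu> j \<noteq> 0"
    \<comment> \<open>The values to avoid are those at which an entry of the combined relation could
      cancel; avoiding 0 brings \<open>j\<close> into the support.\<close>
    have "finite ({0} \<union> (\<lambda>i. - \<rho> i / \<mu> i) ` V)" using fin by simp
    then obtain e where e: "e \<notin> {0} \<union> (\<lambda>i. - \<rho> i / \<mu> i) ` V"
      using ex_new_if_finite[OF infinite_UNIV_char_0] by blast
    let ?\<kappa> = "\<lambda>i. \<rho> i + e * \<mu> i"
    have "(\<Sum>i\<in>V. ?\<kappa> i *\<^sub>R v i) = (\<Sum>i\<in>V. \<rho> i *\<^sub>R v i) + e *\<^sub>R (\<Sum>i\<in>V. \<mu> i *\<^sub>R v i)"
      by (simp add: scaleR_add_left sum.distrib scaleR_sum_right)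
    then have "R ?\<kappa>" using \<rho>(1) \<mu> by (simp add: R_def)
    have "?\<kappa> i \<noteq> 0" if "i \<in> V" "\<rho> i \<noteq> 0" for i
    proof (cases "\<mu> i = 0")
      case False
      show ?thesis
      proof
        assume "?\<kappa> i = 0"
        then have "e = - \<rho> i / \<mu> i" using False by (simp add: field_simps)
        then show False using e that by auto
      qed
    qed (use that in simp)
    then have "supp \<rho> \<subset> supp ?\<kappa>"
      using j e \<open>\<mu> j \<noteq> 0\<close> by (auto simp: supp_def)
    then have "card (supp \<rho>) < card (supp ?\<kappa>)"
      using fin by (intro psubset_card_mono) (auto simp: supp_def)
    then show False using \<rho>(2)[OF \<open>R ?\<kappa>\<close>] by simp
  qed
  then show ?thesis using that \<rho>(1) unfolding R_def by blast
qed

lemma span_image_sum: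
  fixes v :: "'i \<Rightarrow> 'b::real_vector"
  assumes "finite J" "x \<in> span (v ` J)"
  obtains u where "x = (\<Sum>j\<in>J. u j *\<^sub>R v j)"
proof -
  have "\<exists>u. x = (\<Sum>j\<in>J. u j *\<^sub>R v j)"
    using assms
  proof (induction J arbitrary: x rule: finite_induct)
    case (insert a J)
    then obtain k where "x - k *\<^sub>R v a \<in> span (v ` J)"
      by (auto simp: span_insert)
    then obtain u where "x - k *\<^sub>R v a = (\<Sum>j\<in>J. u j *\<^sub>R v j)"
      using insert.IH by blast
    moreover have "(\<Sum>j\<in>J. (u(a := k)) j *\<^sub>R v j) = (\<Sum>j\<in>J. u j *\<^sub>R v j)"
      using insert.hyps by (intro sum.cong) auto
    ultimately have "x = (\<Sum>j\<in>insert a J. (u(a := k)) j *\<^sub>R v j)"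
      using insert.hyps by (simp add: algebra_simps)
    then show ?case by blast
  qed simp
  then show ?thesis using that by blast
qed

text \<open>The assumption puts \<open>v l\<close> outside the span of the other vectors;
  \<open>f\<close> is its component orthogonal to that span.\<close>

lemma dual_functional_exists:
  fixes v :: "'i \<Rightarrow> 'b::euclidean_space"
  assumes fin: "finite V" and l: "l \<in> V"
    and coloop: "\<And>\<mu>. (\<Sum>i\<in>V. \<mu> i *\<^sub>R v i) = 0 \<Longrightarrow> \<mu> l = (0::real)"
  obtains f where "0 < f \<bullet> v l" "\<And>i. i \<in> V \<Longrightarrow> i \<noteq> l \<Longrightarrow> f \<bullet> v i = 0"
proof -
  let ?S = "v ` (V - {l})"
  have "v l \<notin> span ?S"
  proof
    assume "v l \<in> span ?S"
    then obtain u where u: "v l = (\<Sum>i\<in>V - {l}. u i *\<^sub>R v i)"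
      using fin span_image_sum[of "V - {l}"] by blast
    have "(\<Sum>i\<in>V. (u(l := - 1)) i *\<^sub>R v i) = 0"
    proof -
      have "(\<Sum>i\<in>V - {l}. (u(l := - 1)) i *\<^sub>R v i) = (\<Sum>i\<in>V - {l}. u i *\<^sub>R v i)"
        by (intro sum.cong) auto
      then show ?thesis
        using u sum.remove[OF fin l, of "\<lambda>i. (u(l := - 1)) i *\<^sub>R v i"] by simp
    qed
    then show False using coloop by fastforce
  qed
  obtain y z where yz: "y \<in> span ?S" "\<And>w. w \<in> span ?S \<Longrightarrow> orthogonal z w" "v l = y + z"
    using orthogonal_subspace_decomp_exists by metis
  have "z \<noteq> 0" using yz \<open>v l \<notin> span ?S\<close> by auto
  moreover have "z \<bullet> y = 0" using yz by (auto simp: orthogonal_def)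
  ultimately have "0 < z \<bullet> v l" using yz(3) by (simp add: inner_add_right)
  moreover have "z \<bullet> v i = 0" if "i \<in> V" "i \<noteq> l" for i
    using that yz(2)[of "v i"] by (auto simp: orthogonal_def span_base)
  ultimately show ?thesis using that by blast
qed

section \<open>Functionals with disjoint supports from a minimal interior subfamily\<close>

lemma disjoint_functionals_exist:
  fixes v :: "'i \<Rightarrow> 'b::euclidean_space"
  assumes fin: "finite I" and int: "interior_vectors I v T"
    and min: "\<And>S. interior_vectors I v S \<Longrightarrow> card T \<le> card S"
  obtains L f where "L \<subseteq> I" "3 * card T \<le> card L + 2 * DIM('b)"
    "\<And>l. l \<in> L \<Longrightarrow> 0 < f l \<bullet> v l" "\<And>l i. l \<in> L \<Longrightarrow> i \<in> I \<Longrightarrow> 0 \<le> f l \<bullet> v i"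
    "\<And>l l' i. l \<in> L \<Longrightarrow> l' \<in> L \<Longrightarrow> l \<noteq> l' \<Longrightarrow> i \<in> I \<Longrightarrow> 0 < f l \<bullet> v i \<Longrightarrow> f l' \<bullet> v i = 0"
proof -
  have TI: "T \<subseteq> I" using int by (simp add: interior_vectors_def)
  have finT: "finite T" using TI fin finite_subset by blast
  have span_UNIV: "span (v ` I) = UNIV"
  proof (rule ccontr)
    assume "span (v ` I) \<noteq> UNIV"
    then obtain g where g: "g \<noteq> 0" "\<And>x. x \<in> span (v ` I) \<Longrightarrow> g \<bullet> x = 0"
      using span_not_UNIV_orthogonal[of "v ` I"] by blast
    then have "g \<bullet> v i = 0" if "i \<in> I" for i
      using that by (simp add: span_base)
    then show False
      using interior_vectorsD[OF int, of g] g(1) TI by force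
  qed
  obtain B where B: "B \<subseteq> v ` T" "independent B" "v ` T \<subseteq> span B" "card B = dim (v ` T)"
    using basis_exists by blast
  obtain T0 where T0: "T0 \<subseteq> T" "inj_on v T0" "B = v ` T0"
    using B(1) unfolding subset_image_inj by blast
  \<comment> \<open>Whether \<open>T\<close> is interior depends only on its span, so the labels
    \<open>T0\<close> of a basis are interior already, and minimality applies to them.\<close>
  have dimT: "card T \<le> dim (v ` T)"
  proof -
    have "interior_vectors I v T0"
      unfolding interior_vectors_def
    proof (intro conjI allI impI)
      fix g assume g: "(\<forall>i\<in>I. 0 \<le> g \<bullet> v i) \<and> (\<forall>i\<in>T0. g \<bullet> v i = 0)"
      have "orthogonal g x" if "x \<in> span B" for x
        using that g T0(3) by (intro orthogonal_to_span[of x B]) (auto simp: orthogonal_def)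
      then show "g = 0"
        using g B(3) by (intro interior_vectorsD[OF int]) (auto simp: orthogonal_def)
    qed (use T0 TI in auto)
    then show ?thesis
      using min[of T0] B(4) T0 by (simp add: card_image)
  qed
  obtain B' where B': "B \<subseteq> B'" "B' \<subseteq> v ` I" "independent B'" "v ` I \<subseteq> span B'"
    using maximal_independent_subset_extend[of B "v ` I"] B(1,2) TI by blast
  have spanB': "span B' = UNIV"
    using span_minimal[OF B'(4)] span_UNIV by auto
  then have cardB': "card B' = DIM('b)"
    using B'(3) dim_eq_card_independent[of B'] dim_span[of B'] by simp
  obtain P0 where P0: "P0 \<subseteq> I" "inj_on v P0" "B' - B = v ` P0"
    using subset_image_inj[of "B' - B" v I] B'(2) by blast
  have cardP0: "card P0 + dim (v ` T) = DIM('b)"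
  proof -
    have "finite B'" using B'(3) independent_imp_finite by blast
    then have "card (B' - B) + card B = card B'"
      using B'(1) card_Diff_subset[of B B'] card_mono[of B' B] finite_subset by fastforce
    then show ?thesis using P0 cardB' B(4) by (simp add: card_image)
  qed
  \<comment> \<open>Steinitz: \<open>P0\<close> completes \<open>T\<close> to a spanning family, and \<open>Q\<close> expresses the negated sum of \<open>P0\<close> positively.\<close>
  obtain c Q s where Q: "Q \<subseteq> I" "card Q + dim (v ` T) \<le> DIM('b)" "\<And>i. i \<in> Q \<Longrightarrow> (0::real) < c i"
    "s \<in> span (v ` T)" "- (\<Sum>i\<in>P0. v i) = (\<Sum>i\<in>Q. c i *\<^sub>R v i) + s"
    by (rule interior_vectors_caratheodory[OF int fin, where y = "- (\<Sum>i\<in>P0. v i)"]) blast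
  obtain u where u: "s = (\<Sum>i\<in>T. u i *\<^sub>R v i)"
    using span_image_sum[OF finT Q(4)] by blast
  define V where "V = T \<union> P0 \<union> Q"
  have VI: "V \<subseteq> I" using TI P0(1) Q(1) by (auto simp: V_def)
  have finV: "finite V" using VI fin finite_subset by blast
  have "card V \<le> card T + card P0 + card Q"
    using card_Un_le[of "T \<union> P0" Q] card_Un_le[of T P0] by (simp add: V_def)
  \<comment> \<open>Each of \<open>P0\<close> and \<open>Q\<close> has at most
    \<open>DIM('b) - card T\<close> labels.\<close>
  then have cardV: "card V + card T \<le> 2 * DIM('b)"
    using cardP0 Q(2) dimT by linarith
  have spanV: "span (v ` V) = UNIV"
  proof -
    have "B' \<subseteq> v ` V" using P0(3) B(1) unfolding V_def by blast
    then show ?thesis using spanB' span_mono[of B' "v ` V"] by auto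
  qed
  \<comment> \<open>The summands are added, not chosen by cases, because the three sets may overlap.
    The sign of \<open>u\<close> on \<open>T\<close> is arbitrary.\<close>
  define b where "b i = (if i \<in> P0 then 1 else 0) + (if i \<in> Q then c i else 0)
                      + (if i \<in> T then u i else 0)" for i
  have b_rel: "(\<Sum>i\<in>V. b i *\<^sub>R v i) = 0"
  proof -
    have restr: "(\<Sum>i\<in>V. (if i \<in> S then h i else 0) *\<^sub>R v i) = (\<Sum>i\<in>S. h i *\<^sub>R v i)" if "S \<subseteq> V"
      for S and h :: "'i \<Rightarrow> real"
      using that finV by (intro sum.mono_neutral_cong_right) auto
    have "(\<Sum>i\<in>V. b i *\<^sub>R v i) = (\<Sum>i\<in>P0. 1 *\<^sub>R v i) + (\<Sum>i\<in>Q. c i *\<^sub>R v i) + (\<Sum>i\<in>T. u i *\<^sub>R v i)"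
    proof -
      have "P0 \<subseteq> V" "Q \<subseteq> V" "T \<subseteq> V" by (auto simp: V_def)
      then show ?thesis
        using restr[of P0 "\<lambda>_. 1"] restr[of Q c] restr[of T u]
        by (simp only: b_def scaleR_add_left sum.distrib)
    qed
    also have "\<dots> = 0" using Q(5) u by (simp add: algebra_simps neg_eq_iff_add_eq_0)
    finally show ?thesis .
  qed
  have b_pos: "0 < b i" if "i \<in> V - T" for i
    using that Q(3)[of i] by (auto simp: b_def V_def add_pos_pos)
  obtain \<rho> where \<rho>: "(\<Sum>i\<in>V. \<rho> i *\<^sub>R v i) = 0"
    "\<And>\<mu> i. (\<Sum>i\<in>V. \<mu> i *\<^sub>R v i) = 0 \<Longrightarrow> i \<in> V \<Longrightarrow> \<rho> i = 0 \<Longrightarrow> \<mu> i = (0::real)"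
    using max_support_relation[OF finV, of v] by blast
  define L where "L = {i\<in>V. \<rho> i = 0}"
  \<comment> \<open>By maximal support a zero of \<open>\<rho>\<close> is a zero of
    \<open>b\<close>, and \<open>b\<close> is positive off \<open>T\<close>.\<close>
  have LT: "L \<subseteq> T"
    using b_pos \<rho>(2)[OF b_rel] by (force simp: L_def)
  have sum_rel: "(\<Sum>i\<in>V. \<mu> i * (g \<bullet> v i)) = 0" if "(\<Sum>i\<in>V. \<mu> i *\<^sub>R v i) = 0" for \<mu> g
    using arg_cong[OF that, of "\<lambda>x. g \<bullet> x"] by (simp add: inner_sum_right)

  \<comment> \<open>The sign \<open>\<sigma>\<close> treats both halves at once. If \<open>g\<close>
    vanishes where \<open>\<sigma> * \<rho>\<close> is nonnegative, pairing \<open>\<rho>\<close>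
    with \<open>g\<close> gives a zero sum of terms of one sign, so \<open>g\<close> vanishes on the
    spanning \<open>V\<close>.\<close>
  have half: "card T \<le> card {i\<in>V. 0 \<le> \<sigma> * \<rho> i}" if "\<sigma> \<noteq> 0" for \<sigma>
  proof (rule min)
    show "interior_vectors I v {i\<in>V. 0 \<le> \<sigma> * \<rho> i}"
      unfolding interior_vectors_def
    proof (intro conjI allI impI)
      fix g assume g: "(\<forall>i\<in>I. 0 \<le> g \<bullet> v i) \<and> (\<forall>i\<in>{i\<in>V. 0 \<le> \<sigma> * \<rho> i}. g \<bullet> v i = 0)"
      have nn: "0 \<le> - (\<sigma> * \<rho> j) * (g \<bullet> v j)" if "j \<in> V" for j
      proof (cases "0 \<le> \<sigma> * \<rho> j")
        case False
        then show ?thesis using g that VI by (intro mult_nonneg_nonneg) auto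
      qed (use g that in simp)
      have "(\<Sum>j\<in>V. - (\<sigma> * \<rho> j) * (g \<bullet> v j)) = - \<sigma> * (\<Sum>j\<in>V. \<rho> j * (g \<bullet> v j))"
        by (simp add: sum_distrib_left mult.assoc)
      also have "\<dots> = 0" using sum_rel[OF \<rho>(1)] by simp
      finally have "\<forall>j\<in>V. - (\<sigma> * \<rho> j) * (g \<bullet> v j) = 0"
        using sum_nonneg_eq_0_iff[OF finV, of "\<lambda>j. - (\<sigma> * \<rho> j) * (g \<bullet> v j)"] nn by blast
      then have "g \<bullet> v j = 0" if "j \<in> V" for j
        using g that by (cases "0 \<le> \<sigma> * \<rho> j") fastforce+
      then show "g = 0" by (rule eq_0_if_orthogonal_spanning[OF spanV])
    qed (use VI in auto)
  qed
  have cardL: "2 * card T \<le> card L + card V"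
  proof -
    let ?P = "{i\<in>V. 0 \<le> \<rho> i}" and ?N = "{i\<in>V. \<rho> i \<le> 0}"
    have "?P \<inter> ?N = L" "?P \<union> ?N = V" by (auto simp: L_def)
    then have "card ?P + card ?N = card V + card L"
      using card_Un_Int[of ?P ?N] finV by simp
    then show ?thesis using half[of 1] half[of "- 1"] by simp
  qed

  \<comment> \<open>\<open>b\<close> vanishes on \<open>L\<close> and \<open>g\<close> on
    \<open>T - L\<close>, so pairing them leaves a zero sum of nonnegative terms over
    \<open>V - T\<close>, where \<open>b\<close> is positive.\<close>
  have zero_off: "g \<bullet> v i = 0" if g: "\<And>i. i \<in> I \<Longrightarrow> 0 \<le> g \<bullet> v i" and gT: "\<And>i. i \<in> T - L \<Longrightarrow> g \<bullet> v i = 0"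
      and i: "i \<in> V - L" for g i
  proof (cases "i \<in> T")
    case False
    have "b i * (g \<bullet> v i) = 0" if "i \<in> V" for i
    proof -
      have "0 \<le> b j * (g \<bullet> v j)" if "j \<in> V" for j
      proof (cases "j \<in> T")
        case True
        then have "b j = 0 \<or> g \<bullet> v j = 0"
          using gT \<rho>(2)[OF b_rel] that by (auto simp: L_def)
        then show ?thesis by auto
      next
        case False
        then show ?thesis
          using b_pos[of j] g[of j] that VI by auto
      qed
      then show ?thesis
        using sum_nonneg_eq_0_iff[OF finV, of "\<lambda>j. b j * (g \<bullet> v j)"] sum_rel[OF b_rel, of g] that by auto
    qed
    then show ?thesis using b_pos[of i] i False by fastforce
  qed (use gT i in auto)

  have "\<exists>f. 0 < f \<bullet> v l \<and> (\<forall>i\<in>V. i \<noteq> l \<longrightarrow> f \<bullet> v i = 0)" if "l \<in> L" for l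
  proof -
    have "l \<in> V" "\<And>\<mu>. (\<Sum>i\<in>V. \<mu> i *\<^sub>R v i) = 0 \<Longrightarrow> \<mu> l = 0"
      using that \<rho>(2) by (auto simp: L_def)
    then show ?thesis
      by (rule dual_functional_exists[OF finV, where v = v and l = l]) blast+
  qed
  then have "\<forall>l\<in>L. \<exists>f. 0 < f \<bullet> v l \<and> (\<forall>i\<in>V. i \<noteq> l \<longrightarrow> f \<bullet> v i = 0)"
    by blast
  then obtain f where "\<forall>l\<in>L. 0 < f l \<bullet> v l \<and> (\<forall>i\<in>V. i \<noteq> l \<longrightarrow> f l \<bullet> v i = 0)"
    by (rule bchoice[THEN exE])
  then have f: "\<And>l. l \<in> L \<Longrightarrow> 0 < f l \<bullet> v l"
    "\<And>l i. l \<in> L \<Longrightarrow> i \<in> V \<Longrightarrow> i \<noteq> l \<Longrightarrow> f l \<bullet> v i = 0"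
    by blast+

  \<comment> \<open>Up to scaling, the \<open>f l\<close> are dual to \<open>L\<close> on
    \<open>V\<close>; both sides agree on \<open>V\<close>, which spans. So after deleting
    \<open>M\<close> from \<open>T\<close>, only nonnegative combinations of the \<open>f l\<close>
    with \<open>l\<close> in \<open>M\<close> can obstruct interiority.\<close>
  have decomp: "g = (\<Sum>l\<in>M. (g \<bullet> v l / (f l \<bullet> v l)) *\<^sub>R f l)"
    if M: "M \<subseteq> L" and g: "\<And>i. i \<in> I \<Longrightarrow> 0 \<le> g \<bullet> v i" "\<And>i. i \<in> T - M \<Longrightarrow> g \<bullet> v i = 0" for g M
  proof -
    let ?h = "\<Sum>l\<in>M. (g \<bullet> v l / (f l \<bullet> v l)) *\<^sub>R f l"
    have "(g - ?h) \<bullet> v i = 0" if i: "i \<in> V" for i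
    proof -
      have finM: "finite M" by (rule finite_subset[OF subset_trans[OF M LT] finT])
      have "?h \<bullet> v i = (\<Sum>l\<in>M. g \<bullet> v l / (f l \<bullet> v l) * (f l \<bullet> v i))"
        by (simp only: inner_sum_left inner_scaleR_left)
      also have "\<dots> = (\<Sum>l\<in>M. if l = i then g \<bullet> v i else 0)"
      proof (intro sum.cong refl)
        fix l assume "l \<in> M"
        then have l: "l \<in> L" using M by auto
        show "g \<bullet> v l / (f l \<bullet> v l) * (f l \<bullet> v i) = (if l = i then g \<bullet> v i else 0)"
          using f(1)[OF l] f(2)[OF l i] by auto
      qed
      also have "\<dots> = g \<bullet> v i"
      proof (cases "i \<in> M")
        case False
        have "g \<bullet> v i = 0"
        proof (cases "i \<in> L")
          case True
          then show ?thesis using g(2) LT False by auto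
        next
          case False
          then show ?thesis using g M i by (intro zero_off[of g i]) auto
        qed
        then show ?thesis using finM by simp
      qed (use finM in simp)
      finally show ?thesis by (simp only: inner_diff_left diff_self)
    qed
    then have "g - ?h = 0" by (rule eq_0_if_orthogonal_spanning[OF spanV])
    then show ?thesis by simp
  qed
  have nonneg: "0 \<le> f l \<bullet> v i" if l: "l \<in> L" and i: "i \<in> I" for l i
  proof (rule ccontr)
    assume neg: "\<not> ?thesis"
    \<comment> \<open>Here \<open>g\<close> is a nonnegative multiple of \<open>f l\<close>, and the
      negative value at \<open>i\<close> forces the multiple to be zero.\<close>
    have "interior_vectors I v (T - {l})"
      unfolding interior_vectors_def
    proof (intro conjI allI impI)
      fix g assume g: "(\<forall>i\<in>I. 0 \<le> g \<bullet> v i) \<and> (\<forall>i\<in>T - {l}. g \<bullet> v i = 0)"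
      define a where "a = g \<bullet> v l / (f l \<bullet> v l)"
      have ga: "g = a *\<^sub>R f l" using decomp[of "{l}" g] l g by (simp add: a_def)
      have "0 \<le> a" using g f(1)[OF l] l LT TI by (auto simp: a_def)
      moreover have "0 \<le> a * (f l \<bullet> v i)" using g i ga by (metis inner_scaleR_left)
      ultimately have "a = 0" using neg by (auto simp: zero_le_mult_iff)
      then show "g = 0" using ga by simp
    qed (use TI in auto)
    then have "card T \<le> card (T - {l})" by (rule min)
    moreover have "card (T - {l}) < card T"
      using l LT finT by (intro psubset_card_mono) auto
    ultimately show False by simp
  qed
  have disj: "f l' \<bullet> v i = 0"
    if l: "l \<in> L" "l' \<in> L" "l \<noteq> l'" and i: "i \<in> I" "0 < f l \<bullet> v i" for l l' i
  proof (rule ccontr)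
    assume "\<not> ?thesis"
    then have pos': "0 < f l' \<bullet> v i" using nonneg[OF l(2) i(1)] by simp
    \<comment> \<open>Here \<open>g\<close> combines \<open>f l\<close> and \<open>f l'\<close>,
      both positive at \<open>i\<close>, so \<open>g \<bullet> v i = 0\<close> kills both
      coefficients. Two labels leave \<open>T\<close> and at most one enters.\<close>
    have "interior_vectors I v (insert i (T - {l,l'}))"
      unfolding interior_vectors_def
    proof (intro conjI allI impI)
      fix g assume g: "(\<forall>i\<in>I. 0 \<le> g \<bullet> v i) \<and> (\<forall>i\<in>insert i (T - {l,l'}). g \<bullet> v i = 0)"
      define a where "a = g \<bullet> v l / (f l \<bullet> v l)"
      define a' where "a' = g \<bullet> v l' / (f l' \<bullet> v l')"
      have ga: "g = a *\<^sub>R f l + a' *\<^sub>R f l'"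
        using decomp[of "{l,l'}" g] l g by (simp add: a_def a'_def)
      have nn: "0 \<le> a" "0 \<le> a'"
        using g f(1) l LT TI by (auto simp: a_def a'_def intro!: divide_nonneg_pos)
      have "a * (f l \<bullet> v i) + a' * (f l' \<bullet> v i) = 0"
        using g ga by (metis inner_add_left inner_scaleR_left insertI1)
      then have "a = 0 \<and> a' = 0"
        using nn i(2) pos' by (simp add: add_nonneg_eq_0_iff)
      then show "g = 0" using ga by simp
    qed (use TI i in auto)
    then have "card T \<le> card (insert i (T - {l,l'}))" by (rule min)
    moreover have "card (insert i (T - {l,l'})) \<le> Suc (card (T - {l,l'}))"
      by (rule card_insert_le_m1) auto
    moreover have "card (T - {l,l'}) + 2 = card T"
    proof -
      have "{l,l'} \<subseteq> T" using l LT by auto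
      then show ?thesis
        using card_Diff_subset[of "{l,l'}" T] card_mono[OF finT, of "{l,l'}"] l(3) by simp
    qed
    ultimately show False by simp
  qed
  show ?thesis
  proof (rule that[of L f])
    show "L \<subseteq> I" using LT TI by auto
    show "3 * card T \<le> card L + 2 * DIM('b)" using cardL cardV by linarith
  qed (use f nonneg disj in auto)
qed

section \<open>Homogenised point configurations and their faces\<close>

text \<open>Supplies an interior subfamily, so that a smallest one exists. The pair
  \<open>(a, b)\<close> acts as the affine function \<open>a \<bullet> y + b\<close>, whose
  vanishing spreads from the points to their affine hull.\<close>

lemma interior_vectors_lift_all:
  assumes "affine hull (p ` I) = (UNIV :: 'a::euclidean_space set)"
  shows "interior_vectors I (\<lambda>i. (p i, 1 :: real)) I"
  unfolding interior_vectors_def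
proof (intro conjI allI impI)
  fix g :: "'a \<times> real"
  assume g: "(\<forall>i\<in>I. 0 \<le> g \<bullet> (p i, 1)) \<and> (\<forall>i\<in>I. g \<bullet> (p i, 1) = 0)"
  obtain a b where ab: "g = (a, b)" by fastforce
  have "affine hull (p ` I) \<subseteq> {y. a \<bullet> y = - b}"
    using g ab by (intro hull_minimal affine_hyperplane) (auto simp: eq_neg_iff_add_eq_0)
  then have all: "a \<bullet> y = - b" for y using assms by auto
  then have "b = 0" using all[of 0] by simp
  then show "g = 0" using all[of a] ab by (simp add: zero_prod_def)
qed simp

text \<open>The barycentre of \<open>T\<close> is interior to the hull: a supporting hyperplane
  through it would give a nonzero affine function that is nonnegative on the points and has mean
  zero over \<open>T\<close>, hence vanishes on \<open>T\<close>.\<close>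

lemma interior_face_if_interior_vectors:
  fixes p :: "'i \<Rightarrow> 'a::euclidean_space"
  assumes conf: "point_configuration I p"
    and int: "interior_vectors I (\<lambda>i. (p i, 1 :: real)) T"
  shows "interior_face I p T"
proof -
  let ?C = "convex hull (p ` I)"
  have fin: "finite I" and aff: "affine hull (p ` I) = UNIV"
    using conf by (auto simp: point_configuration_def)
  have TI: "T \<subseteq> I" using int by (simp add: interior_vectors_def)
  have finT: "finite T" using TI fin finite_subset by blast
  have ne: "T \<noteq> {}"
  proof
    assume "T = {}"
    \<comment> \<open>The functional \<open>(0, 1)\<close> has the value 1 on every lifted
      point.\<close>
    then have "(0 :: 'a, 1 :: real) = 0"
      by (intro interior_vectorsD[OF int]) auto
    then show False by (simp add: zero_prod_def)
  qed
  then have cT: "0 < card T" using finT by (simp add: card_gt_0_iff)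
  define x where "x = (\<Sum>i\<in>T. (1 / card T) *\<^sub>R p i)"
  have xT: "x \<in> convex hull (p ` T)"
    unfolding x_def using cT finT
    by (intro convex_sum) (auto simp: hull_inc)
  have xC: "x \<in> ?C" using xT hull_mono[of "p ` T" "p ` I"] TI by blast
  have "x \<in> interior ?C"
  proof (rule ccontr)
    assume "x \<notin> interior ?C"
    then have "x \<notin> rel_interior ?C"
      using rel_interior_interior[of ?C] aff by (simp add: affine_hull_convex_hull)
    then obtain a where a: "a \<noteq> 0" "\<And>y. y \<in> ?C \<Longrightarrow> a \<bullet> x \<le> a \<bullet> y"
      using supporting_hyperplane_rel_boundary[OF convex_convex_hull xC] by metis
    have ge: "a \<bullet> x \<le> a \<bullet> p i" if "i \<in> I" for i
      using that by (intro a(2)) (simp add: hull_inc)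
    have "(\<Sum>i\<in>T. a \<bullet> p i - a \<bullet> x) = real (card T) * (a \<bullet> x) - real (card T) * (a \<bullet> x)"
      using cT by (simp add: sum_subtractf x_def inner_sum_right sum_divide_distrib[symmetric])
    then have "\<forall>i\<in>T. a \<bullet> p i - a \<bullet> x = 0"
      using sum_nonneg_eq_0_iff[OF finT, of "\<lambda>i. a \<bullet> p i - a \<bullet> x"] ge TI by auto
    then have "(a, - (a \<bullet> x)) = 0"
      using ge by (intro interior_vectorsD[OF int]) auto
    then show False using a(1) by (simp add: zero_prod_def)
  qed
  then show ?thesis
    using xT ne TI by (auto simp: interior_face_def frontier_def)
qed

lemma codim_le_config_degree:
  fixes p :: "'i \<Rightarrow> 'a::euclidean_space"
  assumes "finite I" "interior_face I p S"
  shows "int DIM('a) - aff_dim (convex hull (p ` S)) \<le> config_degree I p"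
  unfolding config_degree_def
proof (rule Max_ge)
  have "{int DIM('a) - aff_dim (convex hull (p ` S)) | S. interior_face I p S}
      \<subseteq> (\<lambda>S. int DIM('a) - aff_dim (convex hull (p ` S))) ` Pow I"
    by (auto simp: interior_face_def)
  then show "finite {int DIM('a) - aff_dim (convex hull (p ` S)) | S. interior_face I p S}"
    using assms(1) finite_subset by blast
qed (use assms(2) in blast)

text \<open>The factor of \<open>l\<close> is the support of \<open>f l\<close>. The other labels
  lie on the face where the affine function \<open>f l\<close> is zero, which is proper because it
  misses \<open>p l\<close>.\<close>

lemma weak_cayley_decomposition_from_functionals:
  fixes p :: "'i \<Rightarrow> 'a::euclidean_space" and f :: "'i \<Rightarrow> 'a \<times> real"
  assumes L: "finite L" "L \<noteq> {}" "L \<subseteq> I"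
    and pos: "\<And>l. l \<in> L \<Longrightarrow> 0 < f l \<bullet> (p l, 1)"
    and nonneg: "\<And>l i. l \<in> L \<Longrightarrow> i \<in> I \<Longrightarrow> 0 \<le> f l \<bullet> (p i, 1)"
    and disj: "\<And>l l' i. l \<in> L \<Longrightarrow> l' \<in> L \<Longrightarrow> l \<noteq> l' \<Longrightarrow> i \<in> I \<Longrightarrow>
                 0 < f l \<bullet> (p i, 1) \<Longrightarrow> f l' \<bullet> (p i, 1) = 0"
  shows "\<exists>A. weak_cayley_decomposition I p (card L) A"
proof -
  let ?m = "card L" and ?C = "convex hull (p ` I)"
  obtain e where e: "bij_betw e {1..?m} L"
    using ex_bij_betw_nat_finite_1[OF L(1)] by blast
  define s where "s l = {i\<in>I. 0 < f l \<bullet> (p i, 1)}" for l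
  \<comment> \<open>Index 0 collects the labels in no support; \<open>e\<close> numbers the factors
    from 1.\<close>
  define A where "A i = (if i = 0 then I - (\<Union>l\<in>L. s l) else s (e i))" for i :: nat
  have eL: "e i \<in> L" if "i \<in> {1..?m}" for i
    using e that by (auto simp: bij_betw_def)
  have s_disj: "s l \<inter> s l' = {}" if "l \<in> L" "l' \<in> L" "l \<noteq> l'" for l l'
    using disj[OF that] by (force simp: s_def)
  have "weak_cayley_decomposition I p ?m A"
    unfolding weak_cayley_decomposition_def
  proof (intro conjI ballI)
    show "1 \<le> ?m" using L by (simp add: Suc_le_eq card_gt_0_iff)
    have "{..?m} = insert 0 {1..?m}" by auto
    then have "(\<Union>i\<le>?m. A i) = A 0 \<union> (\<Union>i\<in>{1..?m}. A i)"
      by (simp only: UN_insert)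
    also have "(\<Union>i\<in>{1..?m}. A i) = (\<Union>i\<in>{1..?m}. s (e i))"
      by (intro SUP_cong) (auto simp: A_def)
    also have "(\<Union>i\<in>{1..?m}. s (e i)) = (\<Union>l\<in>L. s l)"
    proof -
      have "(\<Union>l\<in>e ` {1..?m}. s l) = (\<Union>l\<in>L. s l)"
        by (simp only: bij_betw_imp_surj_on[OF e])
      then show ?thesis by (simp only: image_image)
    qed
    also have "A 0 \<union> (\<Union>l\<in>L. s l) = I"
      by (auto simp: A_def s_def)
    finally show "(\<Union>i\<le>?m. A i) = I" .
    show "disjoint_family_on A {..?m}"
      unfolding disjoint_family_on_def
    proof (intro ballI impI)
      fix i j assume ij: "i \<in> {..?m}" "j \<in> {..?m}" "i \<noteq> j"
      have "A 0 \<inter> A k = {}" if "k \<in> {1..?m}" for k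
        using eL[OF that] that by (auto simp: A_def)
      moreover have "A i \<inter> A j = {}" if "i \<in> {1..?m}" "j \<in> {1..?m}"
      proof -
        have "e i \<noteq> e j" using inj_onD[OF bij_betw_imp_inj_on[OF e], of i j] ij(3) that by blast
        then show ?thesis using s_disj eL that by (simp add: A_def)
      qed
      moreover have "k = 0 \<or> k \<in> {1..?m}" if "k \<in> {..?m}" for k
        using that by auto
      ultimately show "A i \<inter> A j = {}"
        using ij by (metis Int_commute)
    qed
    fix i assume i: "i \<in> {1..?m}"
    let ?l = "e i"
    have Ai: "A i = s ?l" using i by (simp add: A_def)
    have l: "?l \<in> L" using eL i .
    then have lA: "?l \<in> A i" using L(3) pos by (auto simp: Ai s_def)
    then show "A i \<noteq> {}" by auto
    obtain a b where ab: "f ?l = (a, b)" by fastforce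
    define F where "F = ?C \<inter> {x. a \<bullet> x = - b}"
    have val: "f ?l \<bullet> (p j, 1) = a \<bullet> p j + b" for j
      by (simp add: ab)
    have ge: "- b \<le> a \<bullet> p j" if "j \<in> I" for j
      using nonneg[OF l that] val[of j] by linarith
    then have "?C \<subseteq> {x. a \<bullet> x \<ge> - b}"
      by (intro hull_minimal convex_halfspace_ge) auto
    then have "F face_of ?C"
      unfolding F_def by (intro face_of_Int_supporting_hyperplane_ge) auto
    moreover have I_diff: "I - A i = {x\<in>I. p x \<in> F}"
    proof -
      have "j \<notin> A i \<longleftrightarrow> p j \<in> F" if "j \<in> I" for j
        using ge[OF that] val[of j] that by (auto simp: Ai s_def F_def hull_inc)
      then show ?thesis by blast
    qed
    moreover have "F \<noteq> ?C"
    proof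
      assume "F = ?C"
      moreover have "p ?l \<in> ?C" using l L(3) by (auto simp: hull_inc)
      ultimately show False using lA I_diff l L(3) by blast
    qed
    ultimately show "\<exists>F. F face_of ?C \<and> F \<noteq> ?C \<and> I - A i = {x\<in>I. p x \<in> F}" by blast
  qed
  then show ?thesis by blast
qed

theorem theorem1:
  fixes I :: "'i set" and p :: "'i \<Rightarrow> 'a::euclidean_space"
  assumes "point_configuration I p"
    and "real_of_int (config_degree I p) < real DIM('a) / 3"
  shows "\<exists>m A. weak_cayley_decomposition I p m A \<and>
           int m \<ge> int DIM('a) - 3 * config_degree I p + 1"
proof -
  let ?v = "\<lambda>i. (p i, 1 :: real)"
  have fin: "finite I" and aff: "affine hull (p ` I) = UNIV"
    using assms(1) by (auto simp: point_configuration_def)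
  obtain T where T: "interior_vectors I ?v T"
    "\<And>S. interior_vectors I ?v S \<Longrightarrow> card T \<le> card S"
    using ex_has_least_nat[of "interior_vectors I ?v" I card] interior_vectors_lift_all[OF aff] by auto
  have finT: "finite T"
    using T(1) fin finite_subset by (auto simp: interior_vectors_def)
  have "aff_dim (p ` T) \<le> int (card T) - 1"
    using aff_dim_le_card[of "p ` T"] card_image_le[OF finT, of p] finT by simp
  \<comment> \<open>The convex hull of \<open>T\<close> has dimension at most
    \<open>card T - 1\<close>, so its codimension is at least \<open>d + 1 - card T\<close>.\<close>
  then have deg: "int DIM('a) + 1 - int (card T) \<le> config_degree I p"
    using codim_le_config_degree[OF fin interior_face_if_interior_vectors[OF assms(1) T(1)]]
    by (simp add: aff_dim_convex_hull)
  obtain L f where Lf: "L \<subseteq> I" "3 * card T \<le> card L + 2 * DIM('a \<times> real)"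
    "\<And>l. l \<in> L \<Longrightarrow> 0 < f l \<bullet> ?v l" "\<And>l i. l \<in> L \<Longrightarrow> i \<in> I \<Longrightarrow> 0 \<le> f l \<bullet> ?v i"
    "\<And>l l' i. l \<in> L \<Longrightarrow> l' \<in> L \<Longrightarrow> l \<noteq> l' \<Longrightarrow> i \<in> I \<Longrightarrow> 0 < f l \<bullet> ?v i \<Longrightarrow> f l' \<bullet> ?v i = 0"
    by (rule disjoint_functionals_exist[OF fin T]) blast+
  \<comment> \<open>The lifted dimension is \<open>d + 1\<close>, so \<open>card L\<close> is at
    least \<open>3 (d + 1 - \<delta>) - 2 (d + 1)\<close>.\<close>
  have card: "int DIM('a) - 3 * config_degree I p + 1 \<le> int (card L)"
    using Lf(2) deg by simp
  \<comment> \<open>The bound on the degree makes \<open>L\<close> non-empty, as a decomposition has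
    length at least 1.\<close>
  moreover have "3 * config_degree I p < int DIM('a)"
    using assms(2) by linarith
  ultimately have "L \<noteq> {}" by auto
  moreover have "finite L" using Lf(1) fin finite_subset by blast
  ultimately have "\<exists>A. weak_cayley_decomposition I p (card L) A"
    using Lf by (intro weak_cayley_decomposition_from_functionals[of L I f p]) auto
  then show ?thesis using card by blast
qed

end
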